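(* For every integer $k\ge 2$, $$\limsup_{n\to\infty}\frac{\log SP(n,k)}{n}=\log\frac{k}{k-1}+\frac{\log(k-1)}{k},$$ where $\log$ is taken to any fixed base greater than $1$ (the same on both sides).
   Context: $\mathcal{P}^n_k$ is the set of all $k$-partitions of $\{1,\dots,n\}$, i.e. partitions into exactly $k$ non-empty classes. Two partitions $P=\{P_1,\dots,P_k\}$ and $Q=\{Q_1,\dots,Q_k\}$ in $\mathcal{P}^n_k$ have the Sperner property if $P_i\not\subseteq Q_j$ and $Q_i\not\subseteq P_j$ for all $i,j\in\{1,\dots,k\}$. A set $\mathcal{P}\subseteq\mathcal{P}^n_k$ is a Sperner partition system if all distinct $P,Q\in\mathcal{P}$ have the Sperner property. For $n\ge k$, $SP(n,k)$ is the maximum cardinality of a Sperner partition system in $\mathcal{P}^n_k$. *)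

theory Defs
  imports "HOL-Analysis.Analysis"
begin

definition k_partitions :: "nat \<Rightarrow> nat \<Rightarrow> nat set set set" where
  "k_partitions n k = {P. partition_on {1..n} P \<and> card P = k}"

definition sperner_property :: "nat set set \<Rightarrow> nat set set \<Rightarrow> bool" where
  "sperner_property P Q \<longleftrightarrow> (\<forall>A\<in>P. \<forall>B\<in>Q. \<not> A \<subseteq> B \<and> \<not> B \<subseteq> A)"

definition sperner_partition_system :: "nat \<Rightarrow> nat \<Rightarrow> nat set set set \<Rightarrow> bool" where
  "sperner_partition_system n k F \<longleftrightarrow>
     F \<subseteq> k_partitions n k \<and> (\<forall>P\<in>F. \<forall>Q\<in>F. P \<noteq> Q \<longrightarrow> sperner_property P Q)"

(* The set of cardinalities is finite and contains 0 (empty system), so Max is a genuine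
   maximum.  Only the values for n \<ge> k are meaningful; for n < k this yields 0. *)
definition SP :: "nat \<Rightarrow> nat \<Rightarrow> nat" where
  "SP n k = Max {card F | F. sperner_partition_system n k F}"

end

theory Submission
  imports Defs "HOL-Real_Asymp.Real_Asymp"
begin

text \<open>
  The claimed growth rate is the entropy of a biased coin with probability \<open>1/k\<close>, that is, the
  exponential growth rate of \<open>n choose (n/k)\<close>. The reason is that a Sperner partition system is
  governed by the classes of size about \<open>n/k\<close>.

  Upper bound. Every \<open>k\<close>-partition of \<open>{1..n}\<close> has a class with at most \<open>n div k\<close> elements, and
  the Sperner property forbids two members of a system to have a class in common. Choosing such a
  class from each member is therefore injective, and \<open>SP n k\<close> is at most the number of subsets
  with at most \<open>n div k\<close> elements. The binomial expansion of \<open>(1 + (k - 1)) ^ n\<close> bounds this number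
  by \<open>k ^ n / (k - 1) ^ (n - n div k)\<close> (lemma \<open>SP_mult_power_le\<close>).

  Lower bound. A limit superior only needs the values \<open>n = k * c\<close>. If all classes have
  size \<open>c\<close>, then two partitions have the Sperner property as soon as they have no class in
  common. The exact maximum number of such partitions comes from Baranyai's theorem, but a factor
  that is polynomial in \<open>n\<close> does not change the growth rate, and up to such a factor a greedy choice
  suffices: the classes of a maximal family meet every partition into \<open>c\<close>-sets, and averaging over
  the permutations of the ground set shows that a family of \<open>c\<close>-sets which meets all these
  partitions has at least \<open>(n choose c) / k\<close> elements (lemmas \<open>hitting_set_card_bound\<close> and
  \<open>choose_le_SP\<close>). Finally the term \<open>i = c\<close> is the largest of the \<open>n + 1\<close> terms in the expansion of
  \<open>(1 + (k - 1)) ^ n\<close>, so the upper bound on \<open>n choose c\<close> is attained up to the factor \<open>n + 1\<close>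
  (lemma \<open>power_le_choose\<close>).
\<close>

section \<open>Permutations carrying one subset to another\<close>

lemma ex_permutation_image_eq:
  assumes "finite S" "A \<subseteq> S" "B \<subseteq> S" "card A = card B"
  shows "\<exists>\<sigma>. \<sigma> permutes S \<and> \<sigma> ` A = B"
proof -
  have fin: "finite A" "finite B" using assms finite_subset by auto
  obtain f where f: "bij_betw f A B"
    using finite_same_card_bij[OF fin assms(4)] by blast
  have "card (S - A) = card (S - B)"
    using assms fin by (simp add: card_Diff_subset)
  then obtain g where g: "bij_betw g (S - A) (S - B)"
    using finite_same_card_bij[of "S - A" "S - B"] assms(1) by auto
  define \<sigma> where "\<sigma> x = (if x \<in> A then f x else if x \<in> S then g x else x)" for x
  have 1: "bij_betw \<sigma> A B"
    using f by (rule bij_betw_cong[THEN iffD1, rotated]) (simp add: \<sigma>_def)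
  have 2: "bij_betw \<sigma> (S - A) (S - B)"
    using g by (rule bij_betw_cong[THEN iffD1, rotated]) (simp add: \<sigma>_def)
  have "bij_betw \<sigma> (A \<union> (S - A)) (B \<union> (S - B))"
    by (rule bij_betw_combine[OF 1 2]) auto
  then have "bij_betw \<sigma> S S"
    using assms(2,3) by (simp add: Un_absorb1)
  moreover have "\<sigma> x = x" if "x \<notin> S" for x
    using that assms(2) by (auto simp: \<sigma>_def)
  ultimately have "\<sigma> permutes S" by (rule bij_imp_permutes)
  with 1 show ?thesis by (auto simp: bij_betw_def)
qed

text \<open>The permutations of \<open>S\<close> are sorted by the image of \<open>B\<close>, which is one of the subsets of
  size \<open>card B\<close>. All these images occur equally often: composition with a permutation that
  carries \<open>A1\<close> to \<open>A2\<close> turns the permutations that send \<open>B\<close> to \<open>A1\<close> into ones that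
  send \<open>B\<close> to \<open>A2\<close>.\<close>

lemma card_permutations_image_eq:
  assumes "finite S" "A \<subseteq> S" "B \<subseteq> S" "card A = card B"
  shows "card {\<pi>. \<pi> permutes S \<and> \<pi> ` B = A} * (card S choose card B) = fact (card S)"
proof -
  define X where "X A' = {\<pi>. \<pi> permutes S \<and> \<pi> ` B = A'}" for A'
  define \<C> where "\<C> = {A'. A' \<subseteq> S \<and> card A' = card B}"
  have finX: "finite (X A')" for A'
    using finite_permutations[OF assms(1)] by (rule finite_subset[rotated]) (auto simp: X_def)
  have le: "card (X A1) \<le> card (X A2)" if A12: "A1 \<in> \<C>" "A2 \<in> \<C>" for A1 A2
  proof -
    obtain \<sigma> where \<sigma>: "\<sigma> permutes S" "\<sigma> ` A1 = A2"
      using ex_permutation_image_eq[OF assms(1), of A1 A2] A12 by (auto simp: \<C>_def)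
    have "inj_on ((\<circ>) \<sigma>) (X A1)"
      using permutes_inj[OF \<sigma>(1)] by (auto simp: inj_on_def fun.inj_map_strong fun_eq_iff dest: injD)
    moreover have "(\<circ>) \<sigma> ` X A1 \<subseteq> X A2"
      using \<sigma> by (auto simp: X_def permutes_compose image_comp[symmetric])
    ultimately show ?thesis using finX card_inj_on_le by blast
  qed
  have A: "A \<in> \<C>" using assms by (simp add: \<C>_def)
  have fin\<C>: "finite \<C>" using assms(1) by (simp add: \<C>_def)
  have "\<pi> ` B \<in> \<C>" if "\<pi> permutes S" for \<pi>
    using that image_mono[OF assms(3), of \<pi>]
    by (simp add: \<C>_def permutes_image card_image permutes_inj_on)
  then have "{\<pi>. \<pi> permutes S} = (\<Union>A'\<in>\<C>. X A')"
    by (auto simp: X_def)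
  then have "fact (card S) = card (\<Union>A'\<in>\<C>. X A')"
    using card_permutations[OF refl assms(1)] by metis
  also have "\<dots> = (\<Sum>A'\<in>\<C>. card (X A'))"
    by (rule card_UN_disjoint) (use fin\<C> finX in \<open>auto simp: X_def\<close>)
  also have "\<dots> = (\<Sum>A'\<in>\<C>. card (X A))"
    using le A by (intro sum.cong refl antisym) auto
  also have "\<dots> = card (X A) * (card S choose card B)"
    using n_subsets[OF assms(1), of "card B"] by (simp add: \<C>_def)
  finally show ?thesis by (simp add: X_def)
qed

section \<open>Partitions into classes of equal size\<close>

definition uniform_partition_on :: "'a set \<Rightarrow> nat \<Rightarrow> 'a set set \<Rightarrow> bool" where
  "uniform_partition_on S c P \<longleftrightarrow> partition_on S P \<and> (\<forall>A\<in>P. card A = c)"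

lemma card_uniform_partition_on:
  assumes "finite S" "card S = k * c" "c > 0" "uniform_partition_on S c P"
  shows "card P = k"
proof -
  have "card S = (\<Sum>A\<in>P. card A)"
    using assms by (intro product_partition) (auto simp: uniform_partition_on_def intro: card_ge_0_finite)
  also have "\<dots> = card P * c"
    using assms(4) by (simp add: uniform_partition_on_def)
  finally show ?thesis using assms(2,3) by simp
qed

lemma ex_uniform_partition_on:
  assumes "finite S" "card S = k * c" "c > 0"
  shows "\<exists>P. uniform_partition_on S c P"
  using assms
proof (induction k arbitrary: S)
  case 0
  then show ?case by (auto simp: uniform_partition_on_def partition_on_empty)
next
  case (Suc k)
  obtain A where A: "A \<subseteq> S" "card A = c" "finite A"
    using obtain_subset_with_card_n[of c S] Suc.prems by auto
  have "card (S - A) = k * c"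
    using A Suc.prems by (simp add: card_Diff_subset)
  then obtain P where P: "uniform_partition_on (S - A) c P"
    using Suc.IH[of "S - A"] Suc.prems by auto
  have "disjnt A (\<Union>P)"
    using P by (auto simp: uniform_partition_on_def partition_on_def disjnt_def)
  then have "partition_on S (insert A P)"
    using P A Suc.prems(3) by (subst partition_on_insert) (auto simp: uniform_partition_on_def)
  then show ?case using P A(2) by (auto simp: uniform_partition_on_def)
qed

lemma uniform_partition_on_permute:
  assumes "uniform_partition_on S c P" "\<pi> permutes S"
  shows "uniform_partition_on S c ((`) \<pi> ` P)"
proof -
  have inj: "inj_on \<pi> X" for X using assms(2) permutes_inj_on by blast
  have "{} \<notin> (`) \<pi> ` P"
    using assms(1) by (auto simp: uniform_partition_on_def partition_on_def)
  then have "partition_on S ((`) \<pi> ` P)"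
    using partition_on_inj_image[of S P \<pi>] assms inj
    by (simp add: uniform_partition_on_def permutes_image)
  then show ?thesis
    using assms(1) card_image[OF inj] by (simp add: uniform_partition_on_def)
qed

text \<open>A random permutation carries a fixed class of \<open>P\<close> to a fixed member of \<open>W\<close> with
  probability \<open>1 / (card S choose c)\<close>. The image of \<open>P\<close> is again a uniform partition and meets \<open>W\<close>
  with certainty, so the union bound over \<open>P \<times> W\<close> gives
  \<open>1 \<le> card P * card W / (card S choose c)\<close>.\<close>

lemma hitting_set_card_bound:
  assumes "finite S" "uniform_partition_on S c P"
    and W: "finite W" "\<And>A. A \<in> W \<Longrightarrow> A \<subseteq> S \<and> card A = c"
    and hit: "\<And>Q. uniform_partition_on S c Q \<Longrightarrow> Q \<inter> W \<noteq> {}"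
  shows "card S choose c \<le> card P * card W"
proof -
  define X where "X B A = {\<pi>. \<pi> permutes S \<and> \<pi> ` B = A}" for A B
  have finP: "finite P"
    using assms(1,2) finite_elements by (auto simp: uniform_partition_on_def)
  have P: "B \<subseteq> S \<and> card B = c" if "B \<in> P" for B
    using assms(2) that by (auto simp: uniform_partition_on_def partition_on_def)
  have "{\<pi>. \<pi> permutes S} \<subseteq> (\<Union>(B, A)\<in>P \<times> W. X B A)"
  proof safe
    fix \<pi> assume \<pi>: "\<pi> permutes S"
    then obtain A where "A \<in> (`) \<pi> ` P" "A \<in> W"
      using hit[OF uniform_partition_on_permute[OF assms(2)]] by blast
    then show "\<pi> \<in> (\<Union>(B, A)\<in>P \<times> W. X B A)"
      using \<pi> by (auto simp: X_def)
  qed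
  moreover have "finite (X B A)" for B A
    using finite_permutations[OF assms(1)] by (rule finite_subset[rotated]) (auto simp: X_def)
  ultimately have "card {\<pi>. \<pi> permutes S} \<le> card (\<Union>(B, A)\<in>P \<times> W. X B A)"
    using finP W(1) by (intro card_mono) auto
  also have "\<dots> \<le> (\<Sum>(B, A)\<in>P \<times> W. card (X B A))"
    using card_UN_le[of "P \<times> W" "\<lambda>(B, A). X B A"] finP W(1) by (simp add: split_def)
  finally have "fact (card S) \<le> (\<Sum>(B, A)\<in>P \<times> W. card (X B A))"
    using card_permutations[OF refl assms(1)] by simp
  then have "fact (card S) * (card S choose c)
      \<le> (\<Sum>(B, A)\<in>P \<times> W. card (X B A)) * (card S choose c)"
    by (rule mult_right_mono) simp
  also have "\<dots> = (\<Sum>(B, A)\<in>P \<times> W. fact (card S))"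
    unfolding sum_distrib_right
  proof (intro sum.cong refl, clarify)
    fix B A assume BA: "B \<in> P" "A \<in> W"
    show "card (X B A) * (card S choose c) = fact (card S)"
      using card_permutations_image_eq[OF assms(1), of A B] P[OF BA(1)] W(2)[OF BA(2)]
      by (simp add: X_def)
  qed
  also have "\<dots> = fact (card S) * (card P * card W)"
    by (simp add: card_cartesian_product)
  finally show ?thesis by simp
qed

section \<open>Bounds on the size of Sperner partition systems\<close>

lemma finite_sperner_systems: "finite {F. sperner_partition_system n k F}"
proof (rule finite_subset)
  show "{F. sperner_partition_system n k F} \<subseteq> Pow {P. partition_on {1..n} P}"
    by (auto simp: sperner_partition_system_def k_partitions_def)
qed (simp add: finitely_many_partition_on)

lemma card_le_SP: "sperner_partition_system n k F \<Longrightarrow> card F \<le> SP n k"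
  unfolding SP_def using finite_sperner_systems[of n k]
  by (intro Max_ge) (auto simp: setcompr_eq_image)

lemma SP_attained: "\<exists>F. sperner_partition_system n k F \<and> card F = SP n k"
proof -
  have "sperner_partition_system n k {}"
    by (simp add: sperner_partition_system_def)
  then have "SP n k \<in> {card F | F. sperner_partition_system n k F}"
    unfolding SP_def using finite_sperner_systems[of n k]
    by (intro Max_in) (auto simp: setcompr_eq_image)
  then show ?thesis by auto
qed

text \<open>A maximal family of uniform partitions without common classes is a Sperner partition
  system, because one of two sets of the same finite size contains the other only if they are
  equal. By maximality its classes meet every uniform partition, and a family of \<open>m\<close> partitions has
  only \<open>m * k\<close> classes. One factor \<open>k\<close> comes from this count, the other one from the hitting set
  bound.\<close>

lemma choose_le_SP:
  assumes "k > 0" "c > 0"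
  shows "(k * c) choose c \<le> k\<^sup>2 * SP (k * c) k"
proof -
  define S where "S = {1..k * c}"
  have S: "finite S" "card S = k * c" by (simp_all add: S_def)
  define \<F> where "\<F> = {F. (\<forall>P\<in>F. uniform_partition_on S c P) \<and> disjoint F}"
  \<comment> \<open>A common class of two distinct members is excluded by \<open>disjoint F\<close>: partitions are themselves
    sets of classes.\<close>
  have "\<F> \<subseteq> Pow {P. partition_on S P}"
    by (auto simp: \<F>_def uniform_partition_on_def)
  then have "finite \<F>"
    by (rule finite_subset) (simp add: finitely_many_partition_on S)
  moreover have "{} \<in> \<F>" by (simp add: \<F>_def)
  ultimately obtain F where F: "F \<in> \<F>" and maxF: "\<And>F'. F' \<in> \<F> \<Longrightarrow> F \<subseteq> F' \<Longrightarrow> F' = F"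
    using finite_has_maximal[of \<F>] by blast
  have unif: "uniform_partition_on S c P" if "P \<in> F" for P
    using F that by (simp add: \<F>_def)
  have cardP: "card P = k" if "uniform_partition_on S c P" for P
    using card_uniform_partition_on[OF S assms(2) that] .
  have finF: "finite F"
    using unif finitely_many_partition_on[OF S(1)]
    by (rule_tac finite_subset[rotated]) (auto simp: uniform_partition_on_def)
  have sys: "sperner_partition_system (k * c) k F"
    unfolding sperner_partition_system_def
  proof (intro conjI ballI impI subsetI)
    fix P assume "P \<in> F"
    then show "P \<in> k_partitions (k * c) k"
      using unif[of P] cardP[of P] by (simp add: k_partitions_def uniform_partition_on_def S_def)
  next
    fix P Q assume PQ: "P \<in> F" "Q \<in> F" "P \<noteq> Q"
    then have "P \<inter> Q = {}" using F by (auto simp: \<F>_def disjoint_def)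
    moreover have "finite A \<and> card A = c" if "A \<in> P \<union> Q" for A
      using that unif[OF PQ(1)] unif[OF PQ(2)] assms(2)
      by (auto simp: uniform_partition_on_def intro: card_ge_0_finite)
    ultimately show "sperner_property P Q"
      unfolding sperner_property_def by (metis UnI1 UnI2 card_subset_eq disjoint_iff)
  qed
  have hit: "Q \<inter> \<Union>F \<noteq> {}" if Q: "uniform_partition_on S c Q" for Q
  proof
    assume disj: "Q \<inter> \<Union>F = {}"
    then have "insert Q F \<in> \<F>"
      using F Q by (auto simp: \<F>_def disjoint_def)
    then have "Q \<in> F" using maxF[of "insert Q F"] by auto
    with disj have "Q = {}" by auto
    with cardP[OF Q] assms(1) show False by simp
  qed
  obtain P where P: "uniform_partition_on S c P"
    using ex_uniform_partition_on[OF S assms(2)] by blast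
  have "card (\<Union>F) \<le> (\<Sum>P\<in>F. card P)" by (rule card_Union_le_sum_card)
  also have "\<dots> = card F * k" using unif cardP by simp
  finally have cardU: "card (\<Union>F) \<le> card F * k" .
  have "card S choose c \<le> card P * card (\<Union>F)"
  proof (rule hitting_set_card_bound[OF S(1) P _ _ hit])
    show "finite (\<Union>F)"
      using finF unif finite_elements[OF S(1)] by (auto simp: uniform_partition_on_def)
    show "A \<subseteq> S \<and> card A = c" if "A \<in> \<Union>F" for A
      using that unif unfolding uniform_partition_on_def partition_on_def by blast
  qed
  also have "\<dots> \<le> k * (card F * k)"
    using cardU cardP[OF P] by simp
  also have "\<dots> \<le> k\<^sup>2 * SP (k * c) k"
    using card_le_SP[OF sys] by (simp add: power2_eq_square)
  finally show ?thesis using S(2) by simp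
qed

lemma ex_class_card_le:
  assumes "P \<in> k_partitions n k" "k > 0"
  shows "\<exists>A\<in>P. A \<subseteq> {1..n} \<and> card A \<le> n div k"
proof -
  have P: "partition_on {1..n} P" "card P = k" using assms by (auto simp: k_partitions_def)
  have sub: "A \<subseteq> {1..n}" if "A \<in> P" for A
    using P(1) that by (auto simp: partition_on_def)
  have sum: "n = (\<Sum>A\<in>P. card A)"
    using product_partition[OF P(1)] finite_subset[OF sub] by simp
  have ne: "P \<noteq> {}" and fin: "finite P" using P(2) assms(2) by (auto intro: card_ge_0_finite)
  have "\<exists>A\<in>P. card A \<le> n div k"
  proof (rule ccontr)
    assume "\<not> ?thesis"
    then have "(\<Sum>A\<in>P. Suc (n div k)) \<le> (\<Sum>A\<in>P. card A)"
      by (intro sum_mono) (simp add: not_le Suc_le_eq)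
    then have "k * Suc (n div k) \<le> n" using sum P(2) by simp
    with dividend_less_times_div[OF assms(2), of n] show False by simp
  qed
  with sub show ?thesis by blast
qed

lemma sum_choose_mult_power:
  assumes "k > 0"
  shows "(\<Sum>i\<le>n. (n choose i) * (k - 1) ^ (n - i)) = k ^ n"
  using binomial_ring[of 1 "k - 1" n] assms by simp

text \<open>Small classes chosen from different members of a system are different. The number of
  small sets is compared with \<open>(1 + (k - 1)) ^ n\<close>, where the set of size \<open>i\<close> has
  weight \<open>(k - 1) ^ (n - i)\<close>: small sets have the largest weights.\<close>

lemma SP_mult_power_le:
  assumes "k \<ge> 2"
  shows "SP n k * (k - 1) ^ (n - n div k) \<le> k ^ n"
proof -
  define m where "m = n div k"
  obtain F where F: "sperner_partition_system n k F" "card F = SP n k"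
    using SP_attained by blast
  have "\<forall>P\<in>F. \<exists>A\<in>P. A \<subseteq> {1..n} \<and> card A \<le> m"
    using F(1) ex_class_card_le[of _ n k] assms by (auto simp: sperner_partition_system_def m_def)
  then obtain f where f: "\<And>P. P \<in> F \<Longrightarrow> f P \<in> P \<and> f P \<subseteq> {1..n} \<and> card (f P) \<le> m"
    by metis
  have "inj_on f F"
  proof (rule inj_onI, rule ccontr)
    fix P Q assume "P \<in> F" "Q \<in> F" "f P = f Q" "P \<noteq> Q"
    then show False
      using F(1) f unfolding sperner_partition_system_def sperner_property_def by (metis order_refl)
  qed
  moreover have "f ` F \<subseteq> (\<Union>i\<le>m. {A. A \<subseteq> {1..n} \<and> card A = i})"
    using f by auto
  moreover have "finite (\<Union>i\<le>m. {A. A \<subseteq> {1..n} \<and> card A = i})"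
    by auto
  ultimately have "card F \<le> card (\<Union>i\<le>m. {A. A \<subseteq> {1..n} \<and> card A = i})"
    by (rule card_inj_on_le)
  also have "\<dots> \<le> (\<Sum>i\<le>m. card {A. A \<subseteq> {1..n} \<and> card A = i})"
    by (rule card_UN_le) simp
  also have "\<dots> = (\<Sum>i\<le>m. n choose i)"
    using n_subsets[of "{1..n}"] by simp
  finally have "SP n k * (k - 1) ^ (n - m) \<le> (\<Sum>i\<le>m. (n choose i) * (k - 1) ^ (n - m))"
    using F(2) by (simp add: sum_distrib_right[symmetric])
  also have "\<dots> \<le> (\<Sum>i\<le>m. (n choose i) * (k - 1) ^ (n - i))"
    using assms by (intro sum_mono mult_left_mono power_increasing) auto
  also have "\<dots> \<le> (\<Sum>i\<le>n. (n choose i) * (k - 1) ^ (n - i))"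
    by (intro sum_mono2) (auto simp: m_def intro: order_trans[OF _ div_le_dividend])
  also have "\<dots> = k ^ n" using assms by (intro sum_choose_mult_power) simp
  finally show ?thesis by (simp add: m_def)
qed

text \<open>The summands \<open>t i\<close> of \<open>(1 + (k - 1)) ^ n\<close> satisfy
  \<open>t (Suc i) / t i = (n - i) / ((k - 1) * Suc i)\<close>. For \<open>n = k * c\<close> this quotient is at least \<open>1\<close>
  exactly when \<open>i < c\<close>, so \<open>t c\<close> is the largest of the \<open>n + 1\<close> summands.\<close>

lemma power_le_choose:
  assumes "k \<ge> 2"
  shows "k ^ (k * c) \<le> (k * c + 1) * (((k * c) choose c) * (k - 1) ^ (k * c - c))"
proof -
  define n where "n = k * c"
  define t where "t i = (n choose i) * (k - 1) ^ (n - i)" for i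
  have cn: "c \<le> n" using assms by (simp add: n_def)
  have step: "Suc i * (k - 1) * t (Suc i) = (n - i) * t i" if "i < n" for i
  proof -
    have pow: "(k - 1) * (k - 1) ^ (n - Suc i) = (k - 1) ^ (n - i)"
      using that by (metis Suc_diff_Suc power_Suc)
    have binom: "Suc i * (n choose Suc i) = (n - i) * (n choose i)"
      by (simp only: binomial_absorb_comp binomial_absorption)
    have "Suc i * (k - 1) * t (Suc i)
        = (Suc i * (n choose Suc i)) * ((k - 1) * (k - 1) ^ (n - Suc i))"
      unfolding t_def by (simp only: ac_simps)
    also have "\<dots> = (n - i) * t i"
      unfolding pow binom t_def by (simp only: ac_simps)
    finally show ?thesis .
  qed
  have up: "t i \<le> t (Suc i)" if "i < c" for i
  proof -
    have "k * Suc i \<le> n" unfolding n_def using that by (intro mult_le_mono2) simp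
    then have "Suc i * (k - 1) \<le> n - i"
      using assms by (cases k) (auto simp: algebra_simps)
    then have "Suc i * (k - 1) * t i \<le> (n - i) * t i" by (rule mult_right_mono) simp
    also have "\<dots> = Suc i * (k - 1) * t (Suc i)" using step[of i] that cn by simp
    finally show ?thesis using assms by (simp only: mult_le_cancel1) auto
  qed
  have down: "t (Suc i) \<le> t i" if "c \<le> i" for i
  proof (cases "i < n")
    case True
    have "n \<le> k * i" using that by (simp add: n_def)
    then have "n - i \<le> Suc i * (k - 1)"
      using assms by (cases k) (auto simp: algebra_simps)
    then have "(n - i) * t i \<le> Suc i * (k - 1) * t i" by (rule mult_right_mono) simp
    then have "Suc i * (k - 1) * t (Suc i) \<le> Suc i * (k - 1) * t i"
      using step[OF True] by (simp only:)
    then show ?thesis using assms by (simp only: mult_le_cancel1) auto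
  qed (simp add: t_def binomial_eq_0)
  have "t i \<le> t c" for i
  proof (cases "i \<le> c")
    case True
    then show ?thesis by (induction rule: inc_induct) (auto intro: order_trans[OF up])
  next
    case False
    then have "c \<le> i" by simp
    then show ?thesis by (induction rule: dec_induct) (auto intro: order_trans[OF down])
  qed
  then have "(\<Sum>i\<le>n. t i) \<le> (\<Sum>i\<le>n. t c)" by (rule sum_mono)
  moreover have "(\<Sum>i\<le>n. t i) = k ^ n"
    unfolding t_def using assms by (intro sum_choose_mult_power) simp
  ultimately show ?thesis by (simp add: t_def n_def)
qed

section \<open>The exponential growth rate\<close>

text \<open>The right-hand side is the form in which the rate appears in both bounds, as the
  logarithm of \<open>k / (k - 1) powr (1 - 1 / k)\<close>.\<close>

lemma growth_rate_eq:
  fixes k :: nat and b :: real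
  assumes "k \<ge> 2" "b > 1"
  shows "log b (real k / (real k - 1)) + log b (real k - 1) / real k
    = log b k - (1 - 1 / real k) * log b (real k - 1)"
  using assms by (simp add: log_divide algebra_simps)

lemma log_SP_upper:
  assumes "k \<ge> 2" "b > 1" "n \<ge> 1"
  shows "log b (SP n k) / n \<le> log b (real k / (real k - 1)) + log b (real k - 1) / k"
proof (cases "SP n k = 0")
  case True
  have "0 \<le> log b (real k / (real k - 1))" "0 \<le> log b (real k - 1)"
    using assms by (auto intro!: zero_le_log_cancel_iff[THEN iffD2])
  then have "0 \<le> log b (real k / (real k - 1)) + log b (real k - 1) / k" by simp
  \<comment> \<open>\<open>log b 0\<close> has the default value \<open>0\<close>; this case occurs for \<open>n < k\<close>.\<close>
  moreover have "log b 0 = 0" by (simp add: log_def)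
  ultimately show ?thesis using True by simp
next
  case False
  have k1: "real (k - 1) = real k - 1" "real k - 1 > 0" using assms by auto
  have "real (SP n k * (k - 1) ^ (n - n div k)) \<le> real (k ^ n)"
    using SP_mult_power_le[OF assms(1)] of_nat_le_iff by blast
  then have "log b (SP n k * (real k - 1) ^ (n - n div k)) \<le> log b (real k ^ n)"
    using assms False k1 by (intro log_le_cancel_iff[THEN iffD2]) auto
  then have *: "log b (SP n k) + (n - n div k) * log b (real k - 1) \<le> n * log b k"
    using assms False k1 by (simp add: log_mult log_nat_power)
  have "n * (1 - 1 / real k) \<le> real (n - n div k)"
    using of_nat_div_le_of_nat[of n k, where ?'a = real] by (simp add: of_nat_diff algebra_simps)
  then have "n * (1 - 1 / real k) * log b (real k - 1) \<le> (n - n div k) * log b (real k - 1)"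
    using assms by (intro mult_right_mono) auto
  with * have "log b (SP n k) \<le> n * (log b k - (1 - 1 / real k) * log b (real k - 1))"
    by (simp add: algebra_simps)
  then have "log b (SP n k) / n \<le> log b k - (1 - 1 / real k) * log b (real k - 1)"
    using assms by (simp add: divide_le_eq mult.commute)
  then show ?thesis by (simp only: growth_rate_eq[OF assms(1,2)])
qed

lemma log_SP_lower:
  fixes k c :: nat and b :: real
  assumes "k \<ge> 2" "b > 1" "c \<ge> 1"
  defines "n \<equiv> k * c"
  shows "log b (real k / (real k - 1)) + log b (real k - 1) / k - log b ((n + 1) * k\<^sup>2) / n
    \<le> log b (SP n k) / n"
proof -
  have k1: "real (k - 1) = real k - 1" "real k - 1 > 0" using assms by auto
  have n: "n > 0" "n \<ge> c" using assms by (auto simp: n_def)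
  have "k ^ n \<le> (n + 1) * ((n choose c) * (k - 1) ^ (n - c))"
    using power_le_choose[OF assms(1), of c] by (simp add: n_def)
  also have "\<dots> \<le> (n + 1) * (k\<^sup>2 * SP n k * (k - 1) ^ (n - c))"
    using choose_le_SP[of k c] assms by (intro mult_left_mono mult_right_mono) (auto simp: n_def)
  finally have le: "k ^ n \<le> ((n + 1) * k\<^sup>2) * SP n k * (k - 1) ^ (n - c)"
    by (simp only: mult.assoc)
  have pos: "SP n k > 0" using le assms(1) by (intro Nat.gr0I) simp
  define q where "q = real ((n + 1) * k\<^sup>2)"
  have q: "q > 0" using assms unfolding q_def by (subst of_nat_0_less_iff) simp
  have "real (k ^ n) \<le> real (((n + 1) * k\<^sup>2) * SP n k * (k - 1) ^ (n - c))"
    using le of_nat_le_iff by blast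
  then have "real k ^ n \<le> q * SP n k * (real k - 1) ^ (n - c)"
    unfolding q_def of_nat_mult[symmetric] k1(1)[symmetric] of_nat_power[symmetric] .
  then have "log b (real k ^ n) \<le> log b (q * SP n k * (real k - 1) ^ (n - c))"
    using assms k1 q pos by (intro log_le_cancel_iff[THEN iffD2]) auto
  also have "\<dots> = log b q + log b (SP n k) + (n - c) * log b (real k - 1)"
    using assms k1 q pos by (simp add: log_mult log_nat_power)
  finally have "n * log b k \<le> log b q + log b (SP n k) + (n - c) * log b (real k - 1)"
    using assms by (simp add: log_nat_power)
  moreover have "real (n - c) = n * (1 - 1 / real k)"
    using n assms by (simp add: of_nat_diff n_def field_simps)
  ultimately have "n * (log b k - (1 - 1 / real k) * log b (real k - 1)) - log b q \<le> log b (SP n k)"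
    (is "real n * ?L - _ \<le> _")
    by (simp add: algebra_simps)
  then have "(n * ?L - log b q) / n \<le> log b (SP n k) / n"
    by (rule divide_right_mono) simp
  then have "?L - log b q / n \<le> log b (SP n k) / n"
    using n by (simp only: diff_divide_distrib nonzero_mult_div_cancel_left of_nat_eq_0_iff)
  then show ?thesis by (simp only: growth_rate_eq[OF assms(1,2)] q_def)
qed

lemma log_correction_tendsto_0:
  fixes k :: nat and b :: real
  assumes "k \<ge> 1" "b > 1"
  shows "(\<lambda>n. log b (real ((n + 1) * k\<^sup>2)) / real n) \<longlonglongrightarrow> 0"
proof -
  have "(\<lambda>n. ln (real n + 1) / real n) \<longlonglongrightarrow> 0" by real_asymp
  then have "(\<lambda>n. (ln (real n + 1) / real n + ln (real (k\<^sup>2)) / real n) / ln b) \<longlonglongrightarrow> (0 + 0) / ln b"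
    by (intro tendsto_intros lim_const_over_n) (use assms in auto)
  moreover have "log b (real ((n + 1) * k\<^sup>2)) / real n
      = (ln (real n + 1) / real n + ln (real (k\<^sup>2)) / real n) / ln b" for n
  proof -
    have "ln (real ((n + 1) * k\<^sup>2)) = ln (real n + 1) + ln (real (k\<^sup>2))"
      using assms(1) unfolding of_nat_mult by (subst ln_mult) (auto simp: add.commute)
    then show ?thesis by (simp add: log_def add_divide_distrib mult.commute)
  qed
  ultimately show ?thesis by simp
qed

theorem theorem7p1p11:
  fixes k :: nat and b :: real
  assumes "k \<ge> 2" and "b > 1"
  shows "limsup (\<lambda>n. ereal (log b (real (SP n k)) / real n)) =
         ereal (log b (real k / (real k - 1)) + log b (real k - 1) / real k)"
    (is "limsup ?X = ereal ?L")
proof (rule antisym)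
  have "\<forall>\<^sub>F n in sequentially. ?X n \<le> ereal ?L"
    using eventually_ge_at_top[of 1] by eventually_elim (use log_SP_upper assms in auto)
  then show "limsup ?X \<le> ereal ?L" by (rule Limsup_bounded)
next
  \<comment> \<open>\<open>Suc c\<close> keeps the class size positive.\<close>
  define r where "r c = k * Suc c" for c
  have r: "strict_mono r" using assms(1) by (auto simp: strict_mono_def r_def)
  define Y where "Y n = ?L - log b (real ((n + 1) * k\<^sup>2)) / real n" for n :: nat
  have "Y \<longlonglongrightarrow> ?L - 0"
    unfolding Y_def using assms by (intro tendsto_diff tendsto_const log_correction_tendsto_0) auto
  then have "(\<lambda>c. ereal ((Y \<circ> r) c)) \<longlonglongrightarrow> ereal ?L"
    using LIMSEQ_subseq_LIMSEQ[OF _ r, of Y] by (simp add: o_def)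
  then have "ereal ?L = limsup (\<lambda>c. ereal ((Y \<circ> r) c))"
    by (metis lim_imp_Limsup trivial_limit_sequentially)
  also have "\<dots> \<le> limsup (?X \<circ> r)"
  proof (intro Limsup_mono always_eventually allI)
    fix c
    show "ereal ((Y \<circ> r) c) \<le> (?X \<circ> r) c"
      using log_SP_lower[OF assms, of "Suc c"] by (simp add: Y_def r_def)
  qed
  also have "\<dots> \<le> limsup ?X" by (rule limsup_subseq_mono[OF r])
  finally show "ereal ?L \<le> limsup ?X" .
qed

end
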